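(* For every integer $n\geq 1$, let $P_n$ be the orthogonal projection of $L^2([0,1])$ onto the space $\mathcal{S}_n$ of piecewise linear continuous functions on $[0,1]$ with knots $\{i/n : 0\leq i\leq n\}$, and let $\|P_n\|_1$ denote its operator norm with respect to the $L^1$-norm. Then the sequence $(\|P_n\|_1)_{n\geq 1}$ is strictly increasing, i.e. $\|P_n\|_1<\|P_{n+1}\|_1$ for all integers $n\geq 1$.
   Context: For an integer $n\geq 1$, $\mathcal{S}_n$ is the $(n+1)$-dimensional space of continuous functions $f:[0,1]\to\mathbb{R}$ that are affine on each interval $[(i-1)/n,\,i/n]$, $1\leq i\leq n$. $P_n:L^2([0,1])\to\mathcal{S}_n$ is the orthogonal projection with respect to the inner product $\langle f,g\rangle=\int_0^1 f(x)g(x)\,dx$. The norm is $\|P_n\|_1=\sup\{\|P_nf\|_{L^1([0,1])} : f\in L^2([0,1]),\ \|f\|_{L^1([0,1])}\leq 1\}$, which is finite and equals the operator norm of the continuous extension of $P_n$ to $L^1([0,1])$. *)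

theory Defs
  imports "HOL-Analysis.Analysis"
begin

text \<open>
  Functions on the unit interval are represented by functions of type \<^typ>\<open>real \<Rightarrow> real\<close>.
  Elements of \<open>L\<^sup>2([0,1])\<close> are represented by arbitrary measurable representatives; all integrals
  below depend only on the restriction to \<open>[0,1]\<close>, up to null sets.
\<close>

definition L2_unit :: "(real \<Rightarrow> real) set" where
  "L2_unit = {f. f \<in> borel_measurable (lebesgue_on {0..1}) \<and>
                 integrable (lebesgue_on {0..1}) (\<lambda>x. (f x)\<^sup>2)}"

definition L2_inner :: "(real \<Rightarrow> real) \<Rightarrow> (real \<Rightarrow> real) \<Rightarrow> real" where
  "L2_inner f g = (\<integral>x. f x * g x \<partial>lebesgue_on {0..1})"

definition L1_norm :: "(real \<Rightarrow> real) \<Rightarrow> real" where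
  "L1_norm f = (\<integral>x. \<bar>f x\<bar> \<partial>lebesgue_on {0..1})"

text \<open>
  Splines are taken in \<^term>\<open>extensional {0..1}\<close>, so that a function \<open>[0,1] \<rightarrow> \<real>\<close> has exactly one
  representative and the definite description in the projection below is unique.
\<close>

definition spline_space :: "nat \<Rightarrow> (real \<Rightarrow> real) set" where
  "spline_space n = {s. s \<in> extensional {0..1} \<and> continuous_on {0..1} s \<and>
     (\<forall>i\<in>{1..n}. \<exists>a b. \<forall>x\<in>{(real i - 1) / real n..real i / real n}. s x = a * x + b)}"

definition spline_proj :: "nat \<Rightarrow> (real \<Rightarrow> real) \<Rightarrow> real \<Rightarrow> real" where
  "spline_proj n f = (THE p. p \<in> spline_space n \<and>
     (\<forall>g\<in>spline_space n. L2_inner (\<lambda>x. f x - p x) g = 0))"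

definition spline_proj_norm1 :: "nat \<Rightarrow> real" where
  "spline_proj_norm1 n = Sup {L1_norm (spline_proj n f) | f. f \<in> L2_unit \<and> L1_norm f \<le> 1}"

end

theory Submission
  imports Defs
begin

text \<open>
  The norm has a closed form, from which the monotonicity can be read off. Let \<open>u\<^sub>k + w\<^sub>k \<surd>3 = (2 + \<surd>3)\<^sup>k\<close>
  and \<open>R\<^sub>m = \<Sum>i<m. 1 / (3 (u\<^sub>i + w\<^sub>i))\<close>; then \<open>\<parallel>P\<^sub>n\<parallel>\<^sub>1 = 2 - R\<^sub>n / w\<^sub>n\<close>. The denominator at least triples
  when \<open>n\<close> grows by one, while the numerator at most doubles, so the quotient strictly decreases
  (\<open>lebesgue_const_less\<close>).

  For the closed form, expand \<open>P\<^sub>n f = \<Sum>j\<le>n. \<langle>f, N\<^sub>j\<rangle> D\<^sub>j\<close> in the basis \<open>D\<^sub>j\<close> of splines dual to the hat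
  functions \<open>N\<^sub>j\<close>. The hat functions are nonnegative with sum 1, hence
  \<open>\<Sum>j\<le>n. \<bar>\<langle>f, N\<^sub>j\<rangle>\<bar> \<le> \<parallel>f\<parallel>\<^sub>1\<close> and \<open>\<parallel>P\<^sub>n f\<parallel>\<^sub>1 \<le> \<parallel>f\<parallel>\<^sub>1 max\<^sub>j \<parallel>D\<^sub>j\<parallel>\<^sub>1\<close>. Conversely, functions that concentrate at
  the end point 0 are mapped close to \<open>D\<^sub>0\<close>. So the norm equals \<open>\<parallel>D\<^sub>0\<parallel>\<^sub>1\<close> as soon as \<open>D\<^sub>0\<close> is
  the largest of the \<open>D\<^sub>j\<close> (\<open>norm_dual_le\<close>).

  The Gram matrix of the hat functions is \<open>1/(6n)\<close> times the tridiagonal matrix with rows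
  \<open>(1, 4, 1)\<close> and corner entries 2. Its inverse is explicit in terms of the sequence \<open>u\<close>, with
  entries of alternating signs; these are the nodal values \<open>dual_coeff\<close> of the \<open>D\<^sub>j\<close>
  (\<open>dual_reproducing\<close>). As \<open>D\<^sub>j\<close> changes sign on every mesh interval, its norm is \<open>1/n\<close> times a sum of terms
  \<open>(a\<^sup>2 + b\<^sup>2) / (2 (a + b))\<close> over neighbouring absolute nodal values, and by Pell's equation
  \<open>u\<^sup>2 = 1 + 3 w\<^sup>2\<close> this sum telescopes up to the correction \<open>R\<close>. The result is
  \<open>\<parallel>D\<^sub>j\<parallel>\<^sub>1 = 2 - (u\<^bsub>n-j\<^esub> R\<^sub>j + u\<^sub>j R\<^bsub>n-j\<^esub>) / w\<^sub>n\<close> (\<open>norm_dual\<close>), which is largest for \<open>j = 0\<close> because \<open>R\<close> is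
  subadditive and \<open>u \<ge> 1\<close>.
\<close>

section \<open>Pell sequences and the closed form of the norm\<close>

text \<open>
  With \<open>\<alpha> = arcosh 2\<close>, these are \<open>cosh (k \<alpha>)\<close> and \<open>sinh (k \<alpha>) / sinh \<alpha>\<close>; both solve the recurrence
  \<open>x\<^bsub>k-1\<^esub> - 4 x\<^sub>k + x\<^bsub>k+1\<^esub> = 0\<close>. With alternating signs, they are therefore annihilated by the interior
  rows of the Gram matrix of the hat functions, and \<open>pell_u\<close> also by its first row.
\<close>

fun pell_u :: "nat \<Rightarrow> real" and pell_w :: "nat \<Rightarrow> real" where
  "pell_u 0 = 1" | "pell_u (Suc k) = 2 * pell_u k + 3 * pell_w k"
| "pell_w 0 = 0" | "pell_w (Suc k) = pell_u k + 2 * pell_w k"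

text \<open>Since \<open>3 (pell_u i + pell_w i) = pell_u i + pell_u (i + 1)\<close>, these are the reciprocals of the
  denominators that arise when the norms of the dual splines are computed.\<close>

definition recip_sum :: "nat \<Rightarrow> real" where "recip_sum m = (\<Sum>i<m. 1 / (3 * (pell_u i + pell_w i)))"

lemma pell_pos: "pell_u k \<ge> 1 \<and> pell_w k \<ge> 0"
  by (induction k) auto

lemma pell_u_pos: "pell_u k > 0" using pell_pos[of k] by linarith
lemma pell_w_nonneg: "pell_w k \<ge> 0" using pell_pos[of k] by linarith

lemma pell_w_pos: "k > 0 \<Longrightarrow> pell_w k > 0"
  using pell_u_pos pell_w_nonneg by (cases k) (auto simp: add_pos_nonneg)

lemma pell_equation: "(pell_u k)\<^sup>2 = 1 + 3 * (pell_w k)\<^sup>2"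
  by (induction k) (auto simp: power2_eq_square algebra_simps)

lemma pell_add: "pell_u (a + b) = pell_u a * pell_u b + 3 * pell_w a * pell_w b \<and> pell_w (a + b) = pell_u a * pell_w b + pell_w a * pell_u b"
  by (induction a) (auto simp: algebra_simps)

lemma pell_w_split: "j \<le> n \<Longrightarrow> pell_u (n - j) * pell_w j + pell_u j * pell_w (n - j) = pell_w n"
  using pell_add[of j "n - j"] by (simp add: algebra_simps)

lemma recip_sum_Suc: "recip_sum (Suc m) = recip_sum m + 1 / (3 * (pell_u m + pell_w m))"
  by (simp add: recip_sum_def)

lemma recip_sum_0: "recip_sum 0 = 0"
  by (simp add: recip_sum_def)

lemma mono_pell: "mono (\<lambda>k. pell_u k + pell_w k)"
  unfolding mono_iff_le_Suc
proof
  fix k show "pell_u k + pell_w k \<le> pell_u (Suc k) + pell_w (Suc k)" using pell_pos[of k] by simp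
qed

text \<open>The terms of \<open>recip_sum\<close> decrease, so a block of \<open>b\<close> of them is largest at the start.\<close>

lemma recip_sum_subadd: "recip_sum (a + b) \<le> recip_sum a + recip_sum b"
proof (induction b)
  case (Suc b)
  have "pell_u b + pell_w b \<le> pell_u (a + b) + pell_w (a + b)"
    using monoD[OF mono_pell, of b "a + b"] by simp
  then have "1 / (3 * (pell_u (a+b) + pell_w (a+b))) \<le> 1 / (3 * (pell_u b + pell_w b))"
    using pell_u_pos[of b] pell_w_nonneg[of b] by (intro divide_left_mono) auto
  with Suc show ?case by (simp add: recip_sum_Suc)
qed (simp add: recip_sum_0)

lemma recip_sum_ge: "n > 0 \<Longrightarrow> recip_sum n \<ge> 1/3"
proof (induction n)
  case (Suc n)
  show ?case
    using Suc pell_u_pos[of n] pell_w_nonneg[of n] by (cases "n = 0") (auto simp: recip_sum_Suc recip_sum_0 intro: order_trans)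
qed simp

lemma recip_sum_nonneg: "recip_sum n \<ge> 0"
  using recip_sum_ge[of n] by (cases "n = 0") (auto simp: recip_sum_0)

definition lebesgue_const :: "nat \<Rightarrow> real" where "lebesgue_const n = 2 - recip_sum n / pell_w n"

lemma lebesgue_const_less: assumes "n \<ge> 1" shows "lebesgue_const n < lebesgue_const (Suc n)"
proof -
  have "1 / (3 * (pell_u n + pell_w n)) \<le> 1 / 3"
    using pell_pos[of n] by (simp add: divide_simps)
  then have R2: "recip_sum (Suc n) \<le> 2 * recip_sum n" using recip_sum_ge[of n] assms by (simp add: recip_sum_Suc)
  have "pell_u n > pell_w n"
    using pell_equation[of n] power2_less_imp_less[of "pell_w n" "pell_u n"] pell_pos[of n] by (smt (verit) zero_le_power2)
  then have w3: "pell_w (Suc n) > 3 * pell_w n" by simp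
  have wn: "pell_w n > 0" and Rn: "recip_sum n > 0" using pell_w_pos[of n] recip_sum_ge[of n] assms by auto
  have "recip_sum (Suc n) * pell_w n \<le> 2 * recip_sum n * pell_w n" using mult_right_mono[OF R2] wn by simp
  also have "\<dots> < recip_sum n * pell_w (Suc n)"
    using mult_strict_left_mono[OF w3 Rn] mult_pos_pos[OF Rn wn] by (simp add: algebra_simps)
  finally have "recip_sum (Suc n) / pell_w (Suc n) < recip_sum n / pell_w n"
    using wn pell_w_pos[of "Suc n"] by (simp add: divide_simps mult.commute)
  then show ?thesis by (simp add: lebesgue_const_def)
qed

lemma lebesgue_const_pos: assumes "n \<ge> 1" shows "lebesgue_const n > 0"
  using assms
proof (induction n rule: dec_induct)
  case base
  show ?case by (simp add: lebesgue_const_def recip_sum_def)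
next
  case (step n) then show ?case using lebesgue_const_less[of n] by simp
qed

text \<open>This comparison puts the dual spline of largest norm at the end point of the interval.\<close>

lemma recip_sum_le_weighted:
  assumes "j \<le> n"
  shows "recip_sum n \<le> pell_u (n - j) * recip_sum j + pell_u j * recip_sum (n - j)"
proof -
  have "recip_sum n \<le> recip_sum j + recip_sum (n - j)" using recip_sum_subadd[of j "n - j"] assms by simp
  also have "\<dots> \<le> pell_u (n - j) * recip_sum j + pell_u j * recip_sum (n - j)"
    using mult_right_mono[of 1 "pell_u (n-j)" "recip_sum j"] mult_right_mono[of 1 "pell_u j" "recip_sum (n-j)"] pell_pos recip_sum_nonneg
    by (intro add_mono) auto
  finally show ?thesis .
qed

section \<open>Splines and their nodal values\<close>

definition hat :: "nat \<Rightarrow> nat \<Rightarrow> real \<Rightarrow> real" where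
  "hat n i x = max 0 (1 - \<bar>real n * x - real i\<bar>)"

definition interp :: "nat \<Rightarrow> (nat \<Rightarrow> real) \<Rightarrow> real \<Rightarrow> real" where
  "interp n c x = (\<Sum>i\<le>n. c i * hat n i x)"

lemma continuous_hat: "continuous_on A (hat n i)"
  unfolding hat_def by (intro continuous_intros)

lemma continuous_interp: "continuous_on A (interp n c)"
  unfolding interp_def by (intro continuous_intros continuous_hat)

lemma interp_cell:
  assumes n: "n \<ge> 1" and k: "k < n" and x: "x \<in> {real k / n..real (Suc k) / n}"
  shows "interp n c x = c k + (c (Suc k) - c k) * (real n * x - k)"
proof -
  have s: "0 \<le> real n * x - k" "real n * x - k \<le> 1"
    using x n by (auto simp: field_simps)
  have "interp n c x = (\<Sum>i\<in>{k, Suc k}. c i * hat n i x)"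
    unfolding interp_def
  proof (rule sum.mono_neutral_right)
    show "\<forall>i\<in>{..n} - {k, Suc k}. c i * hat n i x = 0"
    proof
      fix i assume "i \<in> {..n} - {k, Suc k}"
      then consider "i + 1 \<le> k" | "i \<ge> k + 2" by force
      then have "\<bar>real n * x - real i\<bar> \<ge> 1" using s by cases auto
      then show "c i * hat n i x = 0" by (simp add: hat_def)
    qed
  qed (use k in auto)
  also have "\<dots> = c k * (1 - (n * x - k)) + c (Suc k) * (n * x - k)"
    using s by (simp add: hat_def max_def)
  finally show ?thesis by (simp add: algebra_simps)
qed

lemma ex_cell:
  assumes "n \<ge> 1" "x \<in> {0..1::real}"
  shows "\<exists>k<n. x \<in> {real k / n..real (Suc k) / n}"
proof (cases "x = 1")
  case True
  with assms show ?thesis by (intro exI[of _ "n - 1"]) (auto simp: field_simps)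
next
  case False
  define k where "k = nat \<lfloor>n * x\<rfloor>"
  have 1: "real k \<le> n * x" "n * x < real k + 1"
    using assms unfolding k_def by (auto simp: of_nat_nat)
  moreover have "n * x < n" using False assms by simp
  ultimately have "real k < real n" by linarith
  with 1 assms show ?thesis by (intro exI[of _ k]) (auto simp: field_simps)
qed

lemma restrict_interp_in: 
  assumes "n \<ge> 1" shows "restrict (interp n c) {0..1} \<in> spline_space n"
  unfolding spline_space_def
proof (intro CollectI conjI ballI)
  show "continuous_on {0..1} (restrict (interp n c) {0..1})"
    using continuous_on_cong[of "{0..1}" "{0..1}" "restrict (interp n c) {0..1}" "interp n c"]
      continuous_interp by simp
  fix i assume i: "i \<in> {1..n}"
  define k where "k = i - 1"
  have k: "k < n" "real i - 1 = real k" "real i = real (Suc k)" using i by (auto simp: k_def)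
  have "restrict (interp n c) {0..1} x = ((c (Suc k) - c k) * n) * x + (c k - (c (Suc k) - c k) * k)"
    if "x \<in> {real k / n..real (Suc k) / n}" for x
  proof -
    have "x \<in> {0..1}"
      using that k assms order_trans[of 0 "real k / n" x] order_trans[of x "real (Suc k) / n" 1] by auto
    then show ?thesis using interp_cell[OF assms k(1) that, of c] by (simp add: algebra_simps)
  qed
  then show "\<exists>a b. \<forall>x\<in>{(real i - 1) / real n..real i / real n}. restrict (interp n c) {0..1} x = a * x + b"
    unfolding k(2) unfolding k(3) by blast
qed simp

lemma spline_eq_interp:
  assumes n: "n \<ge> 1" and g: "g \<in> spline_space n" and x: "x \<in> {0..1}"
  shows "g x = interp n (\<lambda>i. g (real i / n)) x"
proof -
  obtain k where k: "k < n" and xk: "x \<in> {real k / n..real (Suc k) / n}" using ex_cell[OF n x] by blast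
  then have "Suc k \<in> {1..n}" by auto
  then obtain a b where "\<forall>x\<in>{(real (Suc k) - 1) / real n..real (Suc k) / real n}. g x = a * x + b"
    using g unfolding spline_space_def by blast
  then have ab: "g y = a * y + b" if "y \<in> {real k / n..real (Suc k) / n}" for y
    using that by simp
  have "g (real k / n) = a * (real k / n) + b" "g (real (Suc k) / n) = a * (real (Suc k) / n) + b"
    by (rule ab; use n in \<open>simp add: divide_right_mono\<close>)+
  then have "interp n (\<lambda>i. g (real i / n)) x
      = a * (real k / n) + b + a * (real (Suc k) / n - real k / n) * (n * x - k)"
    using interp_cell[OF n k xk, of "\<lambda>i. g (real i / n)"] by (simp add: algebra_simps)
  also have "real (Suc k) / n - real k / n = 1 / n" by (simp add: diff_divide_distrib[symmetric])
  also have "a * (real k / n) + b + a * (1 / n) * (n * x - k) = a * x + b"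
    using n by (simp add: field_simps)
  finally show ?thesis using ab[OF xk] by simp
qed

lemma restrict_spline_interp:
  assumes n: "n \<ge> 1" and g: "g \<in> spline_space n" 
  shows "g = restrict (interp n (\<lambda>i. g (real i / n))) {0..1}"
proof
  fix x show "g x = restrict (interp n (\<lambda>i. g (real i / n))) {0..1} x"
    using spline_eq_interp[OF n g, of x] g by (auto simp: spline_space_def extensional_def restrict_def)
qed

section \<open>Integrals of splines\<close>

text \<open>
  Integration by antiderivatives on each mesh interval, in the local coordinate \<open>n x - k\<close>; the
  factor \<open>1/n\<close> is the mesh width.
\<close>

lemma integral_cells:
  fixes H :: "real \<Rightarrow> real" and h G :: "nat \<Rightarrow> real \<Rightarrow> real"
  assumes n: "n \<ge> 1"
    and H: "\<And>k x. k < n \<Longrightarrow> x \<in> {real k / n..real (Suc k) / n} \<Longrightarrow> H x = h k (n * x - k)"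
    and G: "\<And>k s. k < n \<Longrightarrow> (G k has_real_derivative h k s) (at s)"
    and cont: "continuous_on {0..1} H"
  shows "(\<integral>x. H x \<partial>lebesgue_on {0..1}) = (\<Sum>k<n. G k 1 - G k 0) / n"
proof -
  have "(H has_integral (\<Sum>k<m. (G k 1 - G k 0) / n)) {0..real m / n}" if "m \<le> n" for m
    using that
  proof (induction m)
    case 0
    then show ?case by (simp add: has_integral_refl)
  next
    case (Suc m)
    have "((\<lambda>x. h m (n * x - m)) has_integral G m (n * (real (Suc m) / n) - m) / n - G m (n * (real m / n) - m) / n)
        {real m / n..real (Suc m) / n}"
    proof (rule fundamental_theorem_of_calculus)
      show "real m / n \<le> real (Suc m) / n" by (simp add: divide_right_mono)
      fix x assume "x \<in> {real m / n..real (Suc m) / n}"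
      have "((\<lambda>x. G m (n * x - m) / n) has_real_derivative h m (n * x - m) * n / n) (at x)"
        using Suc.prems
        by (intro DERIV_cdivide DERIV_chain2[OF G]) (auto intro!: derivative_eq_intros)
      then show "((\<lambda>x. G m (n * x - m) / n) has_vector_derivative h m (n * x - m)) (at x within {real m / n..real (Suc m) / n})"
        using n by (simp add: has_real_derivative_iff_has_vector_derivative has_vector_derivative_at_within)
    qed
    then have "(H has_integral G m (n * (real (Suc m) / n) - m) / n - G m (n * (real m / n) - m) / n)
        {real m / n..real (Suc m) / n}"
      by (rule has_integral_eq[rotated]) (use Suc.prems H[of m] in \<open>simp del: of_nat_Suc\<close>)
    then have "(H has_integral (G m 1 - G m 0) / n) {real m / n..real (Suc m) / n}"
      using n by (simp add: diff_divide_distrib)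
    from has_integral_combine[OF _ _ Suc.IH this] Suc.prems n show ?case
      by (simp add: divide_right_mono)
  qed
  from this[of n] have "(H has_integral (\<Sum>k<n. (G k 1 - G k 0) / n)) {0..1}" using n by simp
  moreover have "(\<integral>x. H x \<partial>lebesgue_on {0..1}) = integral {0..1} H"
    by (rule lebesgue_integral_eq_integral)
       (use continuous_imp_integrable_real[OF cont] in auto)
  ultimately show ?thesis by (simp add: integral_unique sum_divide_distrib)
qed

lemma inner_interp:
  assumes n: "n \<ge> 1"
  shows "L2_inner (interp n c) (interp n d) =
    (\<Sum>k<n. c k * (2 * d k + d (Suc k)) + c (Suc k) * (d k + 2 * d (Suc k))) / (6 * n)"
proof -
  define G where "G k s = c k * d k * s + (c k * (d (Suc k) - d k) + d k * (c (Suc k) - c k)) * s^2/2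
       + (c (Suc k) - c k) * (d (Suc k) - d k) * s^3/3" for k s
  have "L2_inner (interp n c) (interp n d) = (\<Sum>k<n. G k 1 - G k 0) / n"
    unfolding L2_inner_def
  proof (rule integral_cells[where h = "\<lambda>k s. (c k + (c (Suc k) - c k) * s) * (d k + (d (Suc k) - d k) * s)"])
    show "(G k has_real_derivative (c k + (c (Suc k) - c k) * s) * (d k + (d (Suc k) - d k) * s)) (at s)" for k s
    proof -
      have "(G k has_real_derivative c k * d k + (c k * (d (Suc k) - d k) + d k * (c (Suc k) - c k)) * s
         + (c (Suc k) - c k) * (d (Suc k) - d k) * s\<^sup>2) (at s)"
        unfolding G_def by (rule derivative_eq_intros refl | simp)+
      then show ?thesis by (simp add: algebra_simps power2_eq_square)
    qed
  qed (use n in \<open>auto intro!: continuous_intros continuous_interp simp: interp_cell\<close>)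
  also have "(\<Sum>k<n. G k 1 - G k 0) = (\<Sum>k<n. (c k * (2 * d k + d (Suc k)) + c (Suc k) * (d k + 2 * d (Suc k))) / 6)"
    by (intro sum.cong) (auto simp: G_def field_simps)
  finally show ?thesis by (simp add: sum_divide_distrib)
qed

text \<open>It provides the antiderivative of the absolute value of an affine function, with no need to
  locate the zero of that function.\<close>

lemma DERIV_x_abs: "((\<lambda>t. t * \<bar>t\<bar>) has_real_derivative 2 * \<bar>x\<bar>) (at (x::real))"
proof (cases "x = 0")
  case True
  have "((\<lambda>h::real. \<bar>h\<bar>) \<longlongrightarrow> \<bar>0\<bar>) (at 0)" by (intro tendsto_intros)
  then have "((\<lambda>h::real. ((0 + h) * \<bar>0 + h\<bar> - 0 * \<bar>0\<bar>) / h) \<longlongrightarrow> 0) (at 0)"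
    by (auto elim!: Lim_transform_eventually simp: eventually_at_filter)
  then show ?thesis using True by (simp add: DERIV_def)
next
  case False
  then consider "x < 0" | "x > 0" by linarith
  then show ?thesis
  proof cases
    case 1
    have "((\<lambda>t. - (t * t)) has_real_derivative 2 * \<bar>x\<bar>) (at x)"
      using 1 by (auto intro!: derivative_eq_intros)
    from has_field_derivative_transform_within_open[OF this, of "{..<0}"] 1 show ?thesis by simp
  next
    case 2
    have "((\<lambda>t. t * t) has_real_derivative 2 * \<bar>x\<bar>) (at x)"
      using 2 by (auto intro!: derivative_eq_intros)
    from has_field_derivative_transform_within_open[OF this, of "{0<..}"] 2 show ?thesis by simp
  qed
qed

text \<open>The integral over \<open>[0,1]\<close> of the absolute value of the affine function with end values \<open>a\<close>
  and \<open>-b\<close>, for \<open>a, b > 0\<close>.\<close>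

definition cell_norm :: "real \<Rightarrow> real \<Rightarrow> real" where
  "cell_norm a b = (a\<^sup>2 + b\<^sup>2) / (2 * (a + b))"

lemma norm_interp:
  assumes n: "n \<ge> 1" and alt: "\<And>k. k < n \<Longrightarrow> c k * c (Suc k) < 0"
  shows "L1_norm (interp n c) = (\<Sum>k<n. cell_norm \<bar>c k\<bar> \<bar>c (Suc k)\<bar>) / n"
proof -
  define G where "G k s = (c k + (c (Suc k) - c k) * s) * \<bar>c k + (c (Suc k) - c k) * s\<bar> / (2 * (c (Suc k) - c k))" for k s
  have "L1_norm (interp n c) = (\<Sum>k<n. G k 1 - G k 0) / n"
    unfolding L1_norm_def
  proof (rule integral_cells[where h = "\<lambda>k s. \<bar>c k + (c (Suc k) - c k) * s\<bar>"])
    fix k s assume k: "k < n"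
    have ne: "c (Suc k) - c k \<noteq> 0" using alt[OF k] by (auto simp: mult_less_0_iff)
    have "(G k has_real_derivative 2 * \<bar>c k + (c (Suc k) - c k) * s\<bar> * (c (Suc k) - c k) / (2 * (c (Suc k) - c k))) (at s)"
      unfolding G_def
      by (intro DERIV_cdivide DERIV_chain2[OF DERIV_x_abs]) (auto intro!: derivative_eq_intros)
    then show "(G k has_real_derivative \<bar>c k + (c (Suc k) - c k) * s\<bar>) (at s)" 
      by (rule back_subst[where P = "\<lambda>D. (G k has_real_derivative D) (at s)"]) (use ne in \<open>simp add: divide_simps; simp add: algebra_simps\<close>)
  qed (use n in \<open>auto intro!: continuous_intros continuous_interp simp: interp_cell\<close>)
  also have "(\<Sum>k<n. G k 1 - G k 0) = (\<Sum>k<n. cell_norm \<bar>c k\<bar> \<bar>c (Suc k)\<bar>)"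
  proof (intro sum.cong refl)
    fix k assume "k \<in> {..<n}"
    then have "c k * c (Suc k) < 0" using alt by simp
    then consider "c k < 0" "c (Suc k) > 0" | "c k > 0" "c (Suc k) < 0" by (auto simp: mult_less_0_iff)
    then show "G k 1 - G k 0 = cell_norm \<bar>c k\<bar> \<bar>c (Suc k)\<bar>"
      by cases (auto simp: G_def cell_norm_def divide_simps power2_eq_square; simp add: algebra_simps)+
  qed
  finally show ?thesis .
qed


section \<open>The dual basis\<close>

text \<open>
  The inverse of the Gram matrix of the hat functions: away from the diagonal, row \<open>j\<close> is a
  multiple of the solution of the homogeneous recurrence that satisfies the left boundary
  condition for \<open>i \<le> j\<close>, and the right one for \<open>i \<ge> j\<close>. The factor \<open>2n/w\<^sub>n\<close> is \<open>6n\<close>, from the scaling of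
  the Gram matrix, divided by the discrete Wronskian \<open>3 w\<^sub>n\<close> of these two solutions.
\<close>

definition dual_coeff :: "nat \<Rightarrow> nat \<Rightarrow> nat \<Rightarrow> real" where
  "dual_coeff n j i = (-1) ^ (i + j) * (2 * real n / pell_w n) * (pell_u (min i j) * pell_u (n - max i j))"

lemma dual_coeff_le: "i \<le> j \<Longrightarrow> dual_coeff n j i = (2 * real n / pell_w n) * pell_u (n - j) * (-1) ^ j * ((-1) ^ i * pell_u i)"
  by (simp add: dual_coeff_def power_add)

lemma dual_coeff_ge: "j \<le> i \<Longrightarrow> dual_coeff n j i = (2 * real n / pell_w n) * pell_u j * (-1) ^ j * ((-1) ^ i * pell_u (n - i))"
  by (simp add: dual_coeff_def power_add)

lemma pell_Suc_diff: "k < m \<Longrightarrow> pell_u (m - k) = 2 * pell_u (m - Suc k) + 3 * pell_w (m - Suc k)"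
  "k < m \<Longrightarrow> pell_w (m - k) = pell_u (m - Suc k) + 2 * pell_w (m - Suc k)"
  by (simp_all add: Suc_diff_Suc[symmetric])

lemma sum_split_at:
  fixes f :: "nat \<Rightarrow> real"
  assumes "j \<le> n" shows "(\<Sum>k<n. f k) = (\<Sum>k<j. f k) + (\<Sum>k=j..<n. f k)"
  using sum.atLeastLessThan_concat[of 0 j n f] assms by (simp add: lessThan_atLeast0)

text \<open>
  Inner products with a dual spline evaluate at a node. On either side of the node \<open>j\<close> the sum over
  the mesh intervals telescopes, because \<open>2 u\<^sub>k - u\<^bsub>k+1\<^esub> = -3 w\<^sub>k\<close> and \<open>u\<^sub>k - 2 u\<^bsub>k+1\<^esub> = -3 w\<^bsub>k+1\<^esub>\<close>; the end
  points contribute nothing as \<open>w\<^sub>0 = 0\<close>, and the two contributions at \<open>j\<close> combine by the addition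
  theorem for \<open>w\<close>.
\<close>

lemma dual_reproducing:
  assumes n: "n \<ge> 1" and j: "j \<le> n"
  shows "L2_inner (interp n c) (interp n (dual_coeff n j)) = c j"
proof -
  define K where "K = 2 * real n / pell_w n * (-1) ^ j"
  define t where "t k = c k * (2 * dual_coeff n j k + dual_coeff n j (Suc k)) + c (Suc k) * (dual_coeff n j k + 2 * dual_coeff n j (Suc k))" for k
  define S where "S k = -3 * (-1) ^ k * pell_w k * c k" for k
  define T where "T k = 3 * (-1) ^ k * pell_w (n - k) * c k" for k
  have "(\<Sum>k<j. t k) = (\<Sum>k<j. K * pell_u (n - j) * (S k - S (Suc k)))"
  proof (rule sum.cong)
    fix k assume "k \<in> {..<j}"
    then have k: "k \<le> j" "Suc k \<le> j" by auto
    show "t k = K * pell_u (n - j) * (S k - S (Suc k))"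
      unfolding t_def dual_coeff_le[OF k(1)] dual_coeff_le[OF k(2)] K_def S_def by (simp add: algebra_simps)
  qed simp
  also have "\<dots> = K * pell_u (n - j) * (S 0 - S j)"
    by (simp add: sum_distrib_left[symmetric] sum_lessThan_telescope')
  finally have left: "(\<Sum>k<j. t k) = K * pell_u (n - j) * (3 * (-1) ^ j * pell_w j * c j)" by (simp add: S_def)
  have "(\<Sum>k=j..<n. t k) = (\<Sum>k=j..<n. K * pell_u j * - (T (Suc k) - T k))"
  proof (rule sum.cong)
    fix k assume "k \<in> {j..<n}"
    then have k: "j \<le> k" "j \<le> Suc k" "k < n" by auto
    show "t k = K * pell_u j * - (T (Suc k) - T k)"
      unfolding t_def dual_coeff_ge[OF k(1)] dual_coeff_ge[OF k(2)] K_def T_def pell_Suc_diff[OF k(3)]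
      by (simp add: algebra_simps)
  qed simp
  also have "\<dots> = K * pell_u j * - (T n - T j)"
    unfolding sum_distrib_left[symmetric] sum_negf using j by (simp add: sum_Suc_diff')
  finally have right: "(\<Sum>k=j..<n. t k) = K * pell_u j * (3 * (-1) ^ j * pell_w (n - j) * c j)" by (simp add: T_def)
  have "(\<Sum>k<n. t k) = K * (3 * (-1) ^ j * c j) * (pell_u (n - j) * pell_w j + pell_u j * pell_w (n - j))"
    unfolding sum_split_at[OF j] left right by (simp add: algebra_simps)
  also have "\<dots> = 6 * n * c j"
    unfolding pell_w_split[OF j] K_def using pell_w_pos[of n] n by (simp add: power_add[symmetric] mult_2[symmetric])
  finally show ?thesis unfolding inner_interp[OF n] t_def using n by simp
qed

lemma cell_norm_scale: "t > 0 \<Longrightarrow> cell_norm (t * a) (t * b) = t * cell_norm a b"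
proof -
  assume t: "t > 0"
  have "cell_norm (t * a) (t * b) = (t * (t * (a\<^sup>2 + b\<^sup>2))) / (t * (2 * (a + b)))"
    unfolding cell_norm_def by (simp add: power2_eq_square algebra_simps)
  also have "\<dots> = t * (a\<^sup>2 + b\<^sup>2) / (2 * (a + b))"
    using t by (subst mult_divide_mult_cancel_left) auto
  finally show ?thesis by (simp add: cell_norm_def)
qed

lemma cell_norm_commute: "cell_norm a b = cell_norm b a"
  by (simp add: cell_norm_def add.commute)

text \<open>
  With \<open>s = u\<^sub>k + u\<^bsub>k+1\<^esub> = 3 (u\<^sub>k + w\<^sub>k)\<close>, Pell's equation gives \<open>u\<^sub>k\<^sup>2 + u\<^bsub>k+1\<^esub>\<^sup>2 = (2/3) s\<^sup>2 - 1\<close>, and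
  \<open>s / 3 = w\<^bsub>k+1\<^esub> - w\<^sub>k\<close> telescopes.
\<close>

lemma cell_norm_pell: "cell_norm (pell_u k) (pell_u (Suc k)) = (pell_w (Suc k) - pell_w k) - 1 / (3 * (pell_u k + pell_w k)) / 2"
proof -
  have "pell_u k + pell_w k > 0" using pell_u_pos[of k] pell_w_nonneg[of k] by simp
  moreover have "(pell_u k)\<^sup>2 + (2 * pell_u k + 3 * pell_w k)\<^sup>2 = 6 * (pell_u k + pell_w k)\<^sup>2 - ((pell_u k)\<^sup>2 - 3 * (pell_w k)\<^sup>2)"
    by (simp add: power2_eq_square algebra_simps)
  moreover have "(pell_u k)\<^sup>2 - 3 * (pell_w k)\<^sup>2 = 1" using pell_equation[of k] by simp
  ultimately show ?thesis
    by (simp add: cell_norm_def divide_simps) (simp add: power2_eq_square algebra_simps)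
qed

lemma sum_cell_norm_pell: "(\<Sum>k<m. cell_norm (pell_u k) (pell_u (Suc k))) = pell_w m - recip_sum m / 2"
proof (induction m)
  case (Suc m)
  define r where "r = 1 / (3 * (pell_u m + pell_w m))"
  show ?case
    unfolding sum.lessThan_Suc Suc.IH unfolding cell_norm_pell recip_sum_Suc unfolding r_def[symmetric]
    by (simp add: add_divide_distrib)
qed (simp add: recip_sum_0)

lemma norm_dual:
  assumes n: "n \<ge> 1" and j: "j \<le> n"
  shows "L1_norm (interp n (dual_coeff n j)) = 2 - (pell_u (n - j) * recip_sum j + pell_u j * recip_sum (n - j)) / pell_w n"
proof -
  have wn: "pell_w n > 0" using pell_w_pos n by simp
  define K where "K = 2 * real n / pell_w n"
  have K: "K > 0" unfolding K_def using n wn by simp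
  have abs: "\<bar>dual_coeff n j i\<bar> = K * pell_u (min i j) * pell_u (n - max i j)" for i
    unfolding dual_coeff_def K_def[symmetric] using K pell_u_pos
    by (simp add: abs_mult power_abs less_imp_le abs_of_pos)
  have "dual_coeff n j k * dual_coeff n j (Suc k) = - (\<bar>dual_coeff n j k\<bar> * \<bar>dual_coeff n j (Suc k)\<bar>)" for k
    unfolding abs by (simp add: dual_coeff_def K_def power_add algebra_simps)
  moreover have "\<bar>dual_coeff n j i\<bar> > 0" for i unfolding abs using K pell_u_pos by simp
  ultimately have alt: "dual_coeff n j k * dual_coeff n j (Suc k) < 0" for k by simp
  define q where "q k = cell_norm \<bar>dual_coeff n j k\<bar> \<bar>dual_coeff n j (Suc k)\<bar>" for k
  have left: "(\<Sum>k<j. q k) = K * pell_u (n - j) * (pell_w j - recip_sum j / 2)"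
  proof -
    have "q k = K * pell_u (n - j) * cell_norm (pell_u k) (pell_u (Suc k))" if "k < j" for k
      unfolding q_def abs using that K pell_u_pos
      by (subst cell_norm_scale[symmetric]) (auto simp: mult_ac min_def max_def simp del: pell_u.simps)
    then show ?thesis by (simp add: sum_cell_norm_pell[symmetric] sum_distrib_left del: pell_u.simps)
  qed
  have right: "(\<Sum>k=j..<n. q k) = K * pell_u j * (pell_w (n - j) - recip_sum (n - j) / 2)"
  proof -
    have "(\<Sum>k=j..<n. q k) = (\<Sum>k<n - j. K * pell_u j * cell_norm (pell_u k) (pell_u (Suc k)))"
    proof (rule sum.reindex_bij_witness[of _ "\<lambda>k. n - Suc k" "\<lambda>k. n - Suc k"])
      fix k assume k: "k \<in> {j..<n}"
      then have "Suc (n - Suc k) = n - k" by auto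
      then show "K * pell_u j * cell_norm (pell_u (n - Suc k)) (pell_u (Suc (n - Suc k))) = q k"
        unfolding q_def abs using k K pell_u_pos
        by (subst cell_norm_scale[symmetric], simp, subst cell_norm_commute)
           (auto simp: mult_ac min_def max_def simp del: pell_u.simps)
    qed auto
    then show ?thesis by (simp add: sum_cell_norm_pell[symmetric] sum_distrib_left del: pell_u.simps)
  qed
  have "L1_norm (interp n (dual_coeff n j)) = (\<Sum>k<n. q k) / n"
    unfolding q_def using norm_interp[OF n, of "dual_coeff n j"] alt by blast
  also have "(\<Sum>k<n. q k) = K * ((pell_u (n - j) * pell_w j + pell_u j * pell_w (n - j)) - (pell_u (n - j) * recip_sum j + pell_u j * recip_sum (n - j)) / 2)"
    unfolding sum_split_at[OF j] left right by (simp add: algebra_simps)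
  also have "\<dots> / n = 2 - (pell_u (n - j) * recip_sum j + pell_u j * recip_sum (n - j)) / pell_w n"
    unfolding pell_w_split[OF j] K_def using wn n by (simp add: field_simps)
  finally show ?thesis .
qed

lemma norm_dual_0: "n \<ge> 1 \<Longrightarrow> L1_norm (interp n (dual_coeff n 0)) = lebesgue_const n"
  by (simp add: norm_dual lebesgue_const_def recip_sum_0)

lemma norm_dual_le: "n \<ge> 1 \<Longrightarrow> j \<le> n \<Longrightarrow> L1_norm (interp n (dual_coeff n j)) \<le> lebesgue_const n"
  using recip_sum_le_weighted[of j n] pell_w_pos[of n] by (simp add: norm_dual lebesgue_const_def divide_right_mono)

section \<open>The projection in terms of the dual basis\<close>

lemma L2_inner_cong:
  "(\<And>x. x \<in> {0..1} \<Longrightarrow> f x = f' x) \<Longrightarrow> (\<And>x. x \<in> {0..1} \<Longrightarrow> g x = g' x) \<Longrightarrow> L2_inner f g = L2_inner f' g'"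
  unfolding L2_inner_def by (rule Bochner_Integration.integral_cong) auto

lemma L1_norm_cong: "(\<And>x. x \<in> {0..1} \<Longrightarrow> f x = f' x) \<Longrightarrow> L1_norm f = L1_norm f'"
  unfolding L1_norm_def by (rule Bochner_Integration.integral_cong) auto

lemma L2_integrable:
  assumes f: "f \<in> L2_unit" shows "integrable (lebesgue_on {0..1}) f"
proof (rule Bochner_Integration.integrable_bound)
  show "integrable (lebesgue_on {0..1}) (\<lambda>x. 1 + (f x)\<^sup>2)"
    using f integrable_const_ivl[of 0 1 "1::real"] unfolding L2_unit_def
    by (intro Bochner_Integration.integrable_add) auto
  have "\<bar>y\<bar> \<le> 1 + y\<^sup>2" for y :: real
    using zero_le_power2[of "\<bar>y\<bar> - 1"] unfolding power2_diff by simp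
  then show "AE x in lebesgue_on {0..1}. norm (f x) \<le> norm (1 + (f x)\<^sup>2)" by (intro AE_I2) (simp add: add_nonneg_nonneg)
qed (use f in \<open>auto simp: L2_unit_def\<close>)

lemma integrable_mult_continuous:
  assumes f: "integrable (lebesgue_on {0..1::real}) f" and g: "continuous_on {0..1} (g :: real \<Rightarrow> real)"
  shows "integrable (lebesgue_on {0..1}) (\<lambda>x. f x * g x)"
proof -
  have "bounded (g ` {0..1})" using g by (intro compact_imp_bounded compact_continuous_image) auto
  then obtain B where B: "\<And>x. x \<in> {0..1} \<Longrightarrow> \<bar>g x\<bar> \<le> B" unfolding bounded_iff by force
  show ?thesis
  proof (rule Bochner_Integration.integrable_bound)
    show "integrable (lebesgue_on {0..1}) (\<lambda>x. B * f x)" using f by simp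
    show "AE x in lebesgue_on {0..1}. norm (f x * g x) \<le> norm (B * f x)"
    proof (intro AE_I2)
      fix x :: real assume "x \<in> space (lebesgue_on {0..1})"
      then have "\<bar>g x\<bar> \<le> \<bar>B\<bar>" using B[of x] by auto
      then show "norm (f x * g x) \<le> norm (B * f x)"
        using mult_right_mono[of "\<bar>g x\<bar>" "\<bar>B\<bar>" "\<bar>f x\<bar>"] by (simp add: abs_mult mult.commute)
    qed
    show "(\<lambda>x. f x * g x) \<in> borel_measurable (lebesgue_on {0..1})"
      using f continuous_imp_measurable_on_sets_lebesgue[OF g]
      by (intro borel_measurable_times) auto
  qed
qed

lemma integrable_continuous: "continuous_on {0..1} (g :: real \<Rightarrow> real) \<Longrightarrow> integrable (lebesgue_on {0..1}) g"
  using continuous_imp_integrable_real by blast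

text \<open>
  The orthogonal projection, without the restriction to \<open>[0,1]\<close>. Pairing \<open>f\<close> with the hat functions,
  and not with the dual splines, is what allows the sharp estimate of the coefficients in
  \<open>sum_abs_coeff_le\<close>.
\<close>

definition dual_expansion :: "nat \<Rightarrow> (real \<Rightarrow> real) \<Rightarrow> real \<Rightarrow> real" where
  "dual_expansion n f x = (\<Sum>j\<le>n. L2_inner f (hat n j) * interp n (dual_coeff n j) x)"

lemma dual_expansion_eq_interp: "dual_expansion n f = interp n (\<lambda>i. \<Sum>j\<le>n. L2_inner f (hat n j) * dual_coeff n j i)"
  unfolding dual_expansion_def interp_def
proof
  fix x
  have "(\<Sum>j\<le>n. L2_inner f (hat n j) * (\<Sum>i\<le>n. dual_coeff n j i * hat n i x))
      = (\<Sum>j\<le>n. \<Sum>i\<le>n. L2_inner f (hat n j) * dual_coeff n j i * hat n i x)"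
    by (simp add: sum_distrib_left mult.assoc)
  also have "\<dots> = (\<Sum>i\<le>n. \<Sum>j\<le>n. L2_inner f (hat n j) * dual_coeff n j i * hat n i x)"
    by (rule sum.swap)
  also have "\<dots> = (\<Sum>i\<le>n. (\<Sum>j\<le>n. L2_inner f (hat n j) * dual_coeff n j i) * hat n i x)"
    by (simp add: sum_distrib_right)
  finally show "(\<Sum>j\<le>n. L2_inner f (hat n j) * (\<Sum>i\<le>n. dual_coeff n j i * hat n i x))
      = (\<Sum>i\<le>n. (\<Sum>j\<le>n. L2_inner f (hat n j) * dual_coeff n j i) * hat n i x)" .
qed

lemma L2_inner_sum_right:
  assumes "integrable (lebesgue_on {0..1}) f" "\<And>j. j \<in> A \<Longrightarrow> continuous_on {0..1} (g j)"
  shows "L2_inner f (\<lambda>x. \<Sum>j\<in>A. c j * g j x) = (\<Sum>j\<in>A. c j * L2_inner f (g j))"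
  unfolding L2_inner_def using integrable_mult_continuous[OF assms(1) assms(2)]
  by (simp add: sum_distrib_left mult.left_commute)

lemma L2_inner_commute: "L2_inner f g = L2_inner g f"
  by (simp add: L2_inner_def mult.commute)

lemma L2_inner_dual_expansion:
  assumes n: "n \<ge> 1" and f: "integrable (lebesgue_on {0..1}) f"
  shows "L2_inner (dual_expansion n f) (interp n c) = L2_inner f (interp n c)"
proof -
  have "L2_inner (dual_expansion n f) (interp n c) = L2_inner (interp n c) (dual_expansion n f)" by (rule L2_inner_commute)
  also have "\<dots> = (\<Sum>j\<le>n. L2_inner f (hat n j) * L2_inner (interp n c) (interp n (dual_coeff n j)))"
    unfolding dual_expansion_def by (intro L2_inner_sum_right integrable_continuous continuous_interp)
  also have "\<dots> = (\<Sum>j\<le>n. c j * L2_inner f (hat n j))"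
    using dual_reproducing[OF n] by (simp add: mult.commute)
  also have "\<dots> = L2_inner f (interp n c)"
    unfolding interp_def by (intro L2_inner_sum_right[symmetric] f continuous_hat)
  finally show ?thesis .
qed

lemma L2_inner_diff:
  assumes "integrable (lebesgue_on {0..1}) f" "continuous_on {0..1} p" "continuous_on {0..1} g"
  shows "L2_inner (\<lambda>x. f x - p x) g = L2_inner f g - L2_inner p g"
  unfolding L2_inner_def left_diff_distrib
  using integrable_mult_continuous[OF _ assms(3)] assms(1) integrable_continuous[OF assms(2)] by simp

text \<open>
  Uniqueness comes from the reproducing property: the nodal value at \<open>j/n\<close> of any orthogonal
  projection of \<open>f\<close> is its inner product with the \<open>j\<close>th dual spline, hence that of \<open>f\<close>.
\<close>

lemma spline_proj_eq:
  assumes n: "n \<ge> 1" and f: "f \<in> L2_unit"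
  shows "spline_proj n f = restrict (dual_expansion n f) {0..1}"
proof -
  note fi = L2_integrable[OF f]
  have orth: "L2_inner (\<lambda>x. f x - interp n c x) g = L2_inner f g - L2_inner (interp n c) g"
    if "g \<in> spline_space n" for c g
    using L2_inner_diff[OF fi] continuous_interp that unfolding spline_space_def by blast
  show ?thesis
    unfolding spline_proj_def
  proof (rule the_equality, intro conjI ballI)
    show "restrict (dual_expansion n f) {0..1} \<in> spline_space n"
      unfolding dual_expansion_eq_interp by (rule restrict_interp_in[OF n])
    fix g assume g: "g \<in> spline_space n"
    define d where "d i = g (real i / n)" for i
    have gd: "g x = interp n d x" if "x \<in> {0..1}" for x
      using spline_eq_interp[OF n g that] by (simp add: d_def[abs_def])
    have "L2_inner (\<lambda>x. f x - restrict (dual_expansion n f) {0..1} x) g = L2_inner (\<lambda>x. f x - dual_expansion n f x) g"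
      by (rule L2_inner_cong) auto
    also have "\<dots> = L2_inner f g - L2_inner (dual_expansion n f) g"
      unfolding dual_expansion_eq_interp by (rule orth[OF g])
    also have "\<dots> = L2_inner f (interp n d) - L2_inner (dual_expansion n f) (interp n d)"
      using L2_inner_cong[of _ _ g "interp n d"] gd by metis
    finally show "L2_inner (\<lambda>x. f x - restrict (dual_expansion n f) {0..1} x) g = 0"
      using L2_inner_dual_expansion[OF n fi] by simp
  next
    fix p assume p: "p \<in> spline_space n \<and> (\<forall>g\<in>spline_space n. L2_inner (\<lambda>x. f x - p x) g = 0)"
    define c where "c i = p (real i / n)" for i
    have pc: "p = restrict (interp n c) {0..1}"
      using restrict_spline_interp[OF n] p by (simp add: c_def[abs_def])
    have "c j = (\<Sum>i\<le>n. L2_inner f (hat n i) * dual_coeff n i j)" if j: "j \<le> n" for j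
    proof -
      let ?g = "restrict (interp n (dual_coeff n j)) {0..1}"
      have g: "?g \<in> spline_space n" by (rule restrict_interp_in[OF n])
      have "0 = L2_inner (\<lambda>x. f x - p x) ?g" using p g by simp
      also have "\<dots> = L2_inner (\<lambda>x. f x - interp n c x) ?g"
        by (rule L2_inner_cong) (auto simp: pc)
      also have "\<dots> = L2_inner f ?g - L2_inner (interp n c) ?g" by (rule orth[OF g])
      also have "L2_inner f ?g = L2_inner f (interp n (dual_coeff n j))"
        by (rule L2_inner_cong) auto
      also have "L2_inner (interp n c) ?g = L2_inner (interp n c) (interp n (dual_coeff n j))"
        by (rule L2_inner_cong) auto
      finally have "c j = L2_inner f (interp n (dual_coeff n j))"
        using dual_reproducing[OF n j] by simp
      also have "\<dots> = L2_inner (dual_expansion n f) (interp n (dual_coeff n j))"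
        using L2_inner_dual_expansion[OF n fi] by simp
      finally show ?thesis unfolding dual_expansion_eq_interp dual_reproducing[OF n j] .
    qed
    then have "interp n c = dual_expansion n f" unfolding dual_expansion_eq_interp by (auto simp: interp_def)
    then show "p = restrict (dual_expansion n f) {0..1}" using pc by simp
  qed
qed

section \<open>The norm of the projection\<close>

lemma hat_nonneg: "hat n i x \<ge> 0" by (simp add: hat_def)

lemma sum_hat: assumes "n \<ge> 1" "x \<in> {0..1}" shows "(\<Sum>j\<le>n. hat n j x) = 1"
proof -
  obtain k where k: "k < n" and xk: "x \<in> {real k / n..real (Suc k) / n}" using ex_cell[OF assms] by blast
  show ?thesis using interp_cell[OF assms(1) k xk, of "\<lambda>_. 1"] by (simp add: interp_def)
qed

lemma sum_abs_coeff_le: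
  assumes n: "n \<ge> 1" and f: "integrable (lebesgue_on {0..1}) f"
  shows "(\<Sum>j\<le>n. \<bar>L2_inner f (hat n j)\<bar>) \<le> L1_norm f"
proof -
  have fa: "integrable (lebesgue_on {0..1}) (\<lambda>x. \<bar>f x\<bar>)" using f by simp
  have "(\<Sum>j\<le>n. \<bar>L2_inner f (hat n j)\<bar>) \<le> (\<Sum>j\<le>n. L2_inner (\<lambda>x. \<bar>f x\<bar>) (hat n j))"
  proof (rule sum_mono)
    fix j
    have "\<bar>L2_inner f (hat n j)\<bar> \<le> (\<integral>x. \<bar>f x * hat n j x\<bar> \<partial>lebesgue_on {0..1})"
      unfolding L2_inner_def by (rule integral_abs_bound)
    then show "\<bar>L2_inner f (hat n j)\<bar> \<le> L2_inner (\<lambda>x. \<bar>f x\<bar>) (hat n j)"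
      by (simp add: L2_inner_def abs_mult hat_nonneg)
  qed
  also have "\<dots> = L2_inner (\<lambda>x. \<bar>f x\<bar>) (\<lambda>x. \<Sum>j\<le>n. 1 * hat n j x)"
    by (subst L2_inner_sum_right[OF fa continuous_hat]) simp
  also have "\<dots> = L2_inner (\<lambda>x. \<bar>f x\<bar>) (\<lambda>x. 1)"
    using sum_hat[OF n] by (intro L2_inner_cong) auto
  finally show ?thesis by (simp add: L2_inner_def L1_norm_def)
qed

lemma L1_norm_restrict: "L1_norm (restrict f {0..1}) = L1_norm f"
  by (rule L1_norm_cong) auto

lemma L1_norm_scale: "L1_norm (\<lambda>x. a * f x) = \<bar>a\<bar> * L1_norm f"
  by (simp add: L1_norm_def abs_mult)

lemma L1_norm_triangle:
  assumes "integrable (lebesgue_on {0..1}) f" "integrable (lebesgue_on {0..1}) g"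
  shows "L1_norm (\<lambda>x. f x + g x) \<le> L1_norm f + L1_norm g"
proof -
  have "L1_norm (\<lambda>x. f x + g x) \<le> (\<integral>x. \<bar>f x\<bar> + \<bar>g x\<bar> \<partial>lebesgue_on {0..1})"
    unfolding L1_norm_def using assms by (intro integral_mono) auto
  also have "\<dots> = L1_norm f + L1_norm g"
    unfolding L1_norm_def using assms by simp
  finally show ?thesis .
qed

lemma L1_norm_sum:
  assumes "finite A" "\<And>j. j \<in> A \<Longrightarrow> integrable (lebesgue_on {0..1}) (f j)"
  shows "L1_norm (\<lambda>x. \<Sum>j\<in>A. f j x) \<le> (\<Sum>j\<in>A. L1_norm (f j))"
  using assms
proof (induction A rule: finite_induct)
  case empty
  then show ?case by (simp add: L1_norm_def)
next
  case (insert a A)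
  then have "L1_norm (\<lambda>x. f a x + (\<Sum>j\<in>A. f j x)) \<le> L1_norm (f a) + L1_norm (\<lambda>x. \<Sum>j\<in>A. f j x)"
    by (intro L1_norm_triangle) auto
  with insert show ?case by simp
qed

lemma norm_dual_sum_le:
  assumes n: "n \<ge> 1" and A: "A \<subseteq> {..n}"
  shows "L1_norm (\<lambda>x. \<Sum>j\<in>A. a j * interp n (dual_coeff n j) x) \<le> (\<Sum>j\<in>A. \<bar>a j\<bar>) * lebesgue_const n"
proof -
  have "L1_norm (\<lambda>x. \<Sum>j\<in>A. a j * interp n (dual_coeff n j) x) \<le> (\<Sum>j\<in>A. L1_norm (\<lambda>x. a j * interp n (dual_coeff n j) x))"
    using A finite_subset by (intro L1_norm_sum integrable_continuous continuous_intros continuous_interp) auto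
  also have "\<dots> \<le> (\<Sum>j\<in>A. \<bar>a j\<bar> * lebesgue_const n)"
    unfolding L1_norm_scale using A norm_dual_le[OF n] by (intro sum_mono mult_left_mono) auto
  finally show ?thesis by (simp add: sum_distrib_right)
qed

lemma norm_spline_proj_le:
  assumes n: "n \<ge> 1" and f: "f \<in> L2_unit"
  shows "L1_norm (spline_proj n f) \<le> L1_norm f * lebesgue_const n"
proof -
  have "L1_norm (spline_proj n f) = L1_norm (dual_expansion n f)"
    by (simp add: spline_proj_eq[OF n f] L1_norm_restrict)
  also have "\<dots> \<le> (\<Sum>j\<le>n. \<bar>L2_inner f (hat n j)\<bar>) * lebesgue_const n"
    unfolding dual_expansion_def[abs_def] by (rule norm_dual_sum_le[OF n]) simp
  also have "\<dots> \<le> L1_norm f * lebesgue_const n"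
    using sum_abs_coeff_le[OF n L2_integrable[OF f]] lebesgue_const_pos[OF n] by (intro mult_right_mono) auto
  finally show ?thesis .
qed

text \<open>
  The coefficients of \<open>f\<close> have absolute sum at most 1. If the one at the node 0 is close to 1, the
  others cannot compensate for the contribution of the dual spline of largest norm.
\<close>

lemma norm_spline_proj_ge:
  assumes n: "n \<ge> 1" and f: "f \<in> L2_unit" and f1: "L1_norm f \<le> 1"
  shows "L1_norm (spline_proj n f) \<ge> (2 * L2_inner f (hat n 0) - 1) * lebesgue_const n"
proof -
  let ?a = "\<lambda>j. L2_inner f (hat n j)" and ?D = "\<lambda>j. interp n (dual_coeff n j)"
  have eq: "(\<Sum>j\<le>n. h j) = h 0 + (\<Sum>j\<in>{1..n}. h j)" for h :: "nat \<Rightarrow> real"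
    by (simp add: atMost_atLeast0 sum.atLeast_Suc_atMost)
  have "?a 0 * lebesgue_const n \<le> \<bar>?a 0\<bar> * lebesgue_const n" using lebesgue_const_pos[OF n] by (intro mult_right_mono) auto
  also have "\<dots> = L1_norm (\<lambda>x. ?a 0 * ?D 0 x)"
    by (simp only: L1_norm_scale norm_dual_0[OF n])
  also have "\<dots> = L1_norm (\<lambda>x. dual_expansion n f x + (\<Sum>j\<in>{1..n}. - ?a j * ?D j x))"
    by (simp add: dual_expansion_def eq sum_negf)
  also have "\<dots> \<le> L1_norm (dual_expansion n f) + L1_norm (\<lambda>x. \<Sum>j\<in>{1..n}. - ?a j * ?D j x)"
    unfolding dual_expansion_eq_interp by (intro L1_norm_triangle integrable_continuous continuous_intros continuous_interp)
  also have "\<dots> \<le> L1_norm (dual_expansion n f) + (\<Sum>j\<in>{1..n}. \<bar>?a j\<bar>) * lebesgue_const n"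
    using norm_dual_sum_le[OF n, of "{1..n}" "\<lambda>j. - ?a j"] by simp
  also have "\<dots> \<le> L1_norm (dual_expansion n f) + (1 - ?a 0) * lebesgue_const n"
    using sum_abs_coeff_le[OF n L2_integrable[OF f]] f1 lebesgue_const_pos[OF n] unfolding eq[of "\<lambda>j. \<bar>?a j\<bar>"]
    by (intro add_left_mono mult_right_mono) auto
  finally show ?thesis
    by (simp add: spline_proj_eq[OF n f] L1_norm_restrict algebra_simps)
qed

lemma ex_concentrated:
  fixes m n :: nat
  assumes n: "n \<ge> 1" and m: "m \<ge> 1"
  shows "\<exists>f\<in>L2_unit. L1_norm f \<le> 1 \<and> L2_inner f (hat n 0) \<ge> 1 - real n / m"
proof -
  \<comment> \<open>half a hat of width \<open>1/m\<close>, normalised to have integral 1\<close>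
  define f where "f x = 2 * real m * hat m 0 x" for x
  have cont: "continuous_on {0..1} f" unfolding f_def by (intro continuous_intros continuous_hat)
  have fi: "integrable (lebesgue_on {0..1}) f" by (rule integrable_continuous[OF cont])
  have L2: "f \<in> L2_unit"
    unfolding L2_unit_def using fi integrable_continuous[OF continuous_on_power[OF cont]] by auto
  have hat_interp: "hat m 0 = interp m (\<lambda>i. if i = 0 then 1 else 0)"
    by (rule ext) (simp add: interp_def if_distrib[of "\<lambda>a. a * _"] cong: if_cong)
  have "L2_inner (hat m 0) (\<lambda>x. 1) = L2_inner (interp m (\<lambda>i. if i = 0 then 1 else 0)) (interp m (\<lambda>i. 1))"
    unfolding hat_interp[symmetric] using sum_hat[OF m] by (intro L2_inner_cong) (auto simp: interp_def)
  also have "\<dots> = (\<Sum>k<m. if k = 0 then 3 else 0) / (6 * m)"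
    unfolding inner_interp[OF m] by (intro arg_cong[of _ _ "\<lambda>x. x / _"] sum.cong) auto
  also have "\<dots> = 1 / (2 * m)" using m by simp
  finally have int1: "(\<integral>x. f x \<partial>lebesgue_on {0..1}) = 1" using m by (simp add: L2_inner_def f_def)
  have f0: "f x \<ge> 0" for x by (simp add: f_def hat_nonneg)
  have "1 - real n / m = (\<integral>x. f x * (1 - real n / m) \<partial>lebesgue_on {0..1})" using int1 by simp
  also have "\<dots> \<le> L2_inner f (hat n 0)"
    unfolding L2_inner_def
  proof (rule integral_mono)
    show "integrable (lebesgue_on {0..1}) (\<lambda>x. f x * hat n 0 x)"
      by (rule integrable_mult_continuous[OF fi continuous_hat])
    fix x :: real assume "x \<in> space (lebesgue_on {0..1})"
    then have x: "x \<ge> 0" by simp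
    show "f x * (1 - real n / m) \<le> f x * hat n 0 x"
    proof (cases "m * x \<le> 1")
      case True
      then have "x \<le> 1 / m" using m by (simp add: field_simps)
      then have "n * x \<le> n / m" using mult_left_mono[of x "1/m" "real n"] by simp
      then have "1 - real n / m \<le> hat n 0 x" using x by (simp add: hat_def)
      then show ?thesis using f0 by (intro mult_left_mono) auto
    next
      case False
      then have "f x = 0" using x by (simp add: f_def hat_def)
      then show ?thesis by simp
    qed
  qed (use fi in simp)
  finally have "L2_inner f (hat n 0) \<ge> 1 - real n / m" .
  moreover have "L1_norm f \<le> 1" using int1 f0 by (simp add: L1_norm_def)
  ultimately show ?thesis using L2 by blast
qed

lemma spline_proj_norm1_eq:
  assumes n: "n \<ge> 1" shows "spline_proj_norm1 n = lebesgue_const n"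
  unfolding spline_proj_norm1_def
proof (rule cSup_eq)
  let ?S = "{L1_norm (spline_proj n f) | f. f \<in> L2_unit \<and> L1_norm f \<le> 1}"
  fix y assume "y \<in> ?S"
  then obtain f where "f \<in> L2_unit" "L1_norm f \<le> 1" "y = L1_norm (spline_proj n f)" by blast
  then show "y \<le> lebesgue_const n" using norm_spline_proj_le[OF n, of f] lebesgue_const_pos[OF n] mult_right_mono[of "L1_norm f" 1 "lebesgue_const n"] by linarith
next
  fix y assume y: "\<And>x. x \<in> {L1_norm (spline_proj n f) | f. f \<in> L2_unit \<and> L1_norm f \<le> 1} \<Longrightarrow> x \<le> y"
  have "(1 - 2 * (real n / m)) * lebesgue_const n \<le> y" if m: "m \<ge> 1" for m :: nat
  proof -
    obtain f where f: "f \<in> L2_unit" "L1_norm f \<le> 1" "L2_inner f (hat n 0) \<ge> 1 - real n / m"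
      using ex_concentrated[OF n m] by blast
    have "(1 - 2 * (real n / m)) * lebesgue_const n \<le> (2 * L2_inner f (hat n 0) - 1) * lebesgue_const n"
      using f(3) lebesgue_const_pos[OF n] by (intro mult_right_mono) auto
    also have "\<dots> \<le> L1_norm (spline_proj n f)" by (rule norm_spline_proj_ge[OF n f(1,2)])
    also have "\<dots> \<le> y" using y f by blast
    finally show ?thesis .
  qed
  then have ev: "\<forall>\<^sub>F m in sequentially. (1 - 2 * (real n / real m)) * lebesgue_const n \<le> y"
    using eventually_sequentially by blast
  have "(\<lambda>m. (1 - 2 * (real n / real m)) * lebesgue_const n) \<longlonglongrightarrow> (1 - 2 * 0) * lebesgue_const n"
    by (intro tendsto_intros lim_const_over_n)
  from tendsto_upperbound[OF this ev] show "lebesgue_const n \<le> y" by simp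
qed

theorem mainTheorem1:
  fixes n :: nat
  assumes "n \<ge> 1"
  shows "spline_proj_norm1 n < spline_proj_norm1 (n + 1)"
  using lebesgue_const_less[OF assms] assms by (simp add: spline_proj_norm1_eq)

end
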